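(* Let $P_N(x):=\prod_{j=1}^Nx_j$ on $\mathbb R^N$. Then $$\lim_{N\to\infty}\frac{\|DP_N\|_{L^1(\gamma_N;\mathbb R^N)}}{\sqrt N\,\|P_N\|_{L^1(\gamma_N)}}=\infty.$$ Consequently, there is no constant $C_1<\infty$ such that $$\|DP\|_{L^1(\gamma_d;\mathbb R^d)}\le C_1\sqrt{\deg P}\,\|P\|_{L^1(\gamma_d)}$$ for every $d\ge1$ and every non-constant polynomial $P:\mathbb R^d\to\mathbb R$.
   Context: $\gamma_d$ is the standard Gaussian measure on $\mathbb R^d$. $DP$ is the gradient of $P$, and $\|DP\|_{L^1(\gamma_d;\mathbb R^d)}=\int|DP|\,d\gamma_d$ with $|\cdot|$ the Euclidean norm. *)

theory Defs
  imports "HOL-Probability.Probability" "HOL-Library.Poly_Mapping"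
begin

(* The dimension is quantified inside the statement, so a point of R^d is a function on nat,
   extensional on the index set {1..d}. *)

definition euclid :: "nat \<Rightarrow> (nat \<Rightarrow> real) set" where
  "euclid d = ({1..d} \<rightarrow>\<^sub>E UNIV)"

definition std_gaussian :: "nat \<Rightarrow> (nat \<Rightarrow> real) measure" where
  "std_gaussian d = PiM {1..d} (\<lambda>_. density lborel std_normal_density)"

lemma space_std_gaussian: "space (std_gaussian d) = euclid d"
  by (simp add: std_gaussian_def euclid_def space_PiM)

lemma prob_space_std_gaussian: "prob_space (std_gaussian d)"
  unfolding std_gaussian_def by (intro prob_space_PiM prob_space_normal_density) simp

definition gradient :: "((nat \<Rightarrow> real) \<Rightarrow> real) \<Rightarrow> (nat \<Rightarrow> real) \<Rightarrow> (nat \<Rightarrow> real)" where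
  "gradient f x = (\<lambda>i. deriv (\<lambda>t. f (x(i := t))) (x i))"

definition L1_norm :: "nat \<Rightarrow> ((nat \<Rightarrow> real) \<Rightarrow> real) \<Rightarrow> real" where
  "L1_norm d f = (LINT x|std_gaussian d. \<bar>f x\<bar>)"

definition L1_norm_vec :: "nat \<Rightarrow> ((nat \<Rightarrow> real) \<Rightarrow> (nat \<Rightarrow> real)) \<Rightarrow> real" where
  "L1_norm_vec d F = (LINT x|std_gaussian d. L2_set (F x) {1..d})"

(* Real polynomials in countably many indeterminates, as finitely supported maps
   from exponent vectors to coefficients. *)

type_synonym mpolynomial = "(nat \<Rightarrow>\<^sub>0 nat) \<Rightarrow>\<^sub>0 real"

definition mpolys :: "nat \<Rightarrow> mpolynomial set" where
  "mpolys d = {p. \<forall>m \<in> Poly_Mapping.keys p. Poly_Mapping.keys m \<subseteq> {1..d}}"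

definition mpoly_eval :: "mpolynomial \<Rightarrow> (nat \<Rightarrow> real) \<Rightarrow> real" where
  "mpoly_eval p x = (\<Sum>m \<in> Poly_Mapping.keys p. Poly_Mapping.lookup p m *
     (\<Prod>i \<in> Poly_Mapping.keys m. x i ^ Poly_Mapping.lookup m i))"

(* Total degree; the zero polynomial gets degree 0. *)
definition mpoly_degree :: "mpolynomial \<Rightarrow> nat" where
  "mpoly_degree p = Max (insert 0
     ((\<lambda>m. \<Sum>i \<in> Poly_Mapping.keys m. Poly_Mapping.lookup m i) ` Poly_Mapping.keys p))"

definition coord_prod :: "nat \<Rightarrow> (nat \<Rightarrow> real) \<Rightarrow> real" where
  "coord_prod N x = (\<Prod>j=1..N. x j)"

end

(*
Almost everywhere |DP_N| = |P_N| sqrt (sum_j x_j^(-2)).  Under the probability measure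
proportional to |P_N| dgamma_N the coordinates are i.i.d. with density proportional to
|x| exp (-x^2/2), and x^(-2) has infinite mean for this density since 1/|x| is not integrable
at 0.  So replace x^(-2) by a truncation g, with a finite mean mu that can be made as large as
desired: by the second moment method (1/N) sum_j g(x_j) concentrates at mu, and the ratio is
eventually at least sqrt mu / 2.  For the second claim, P_N has degree N.
*)
theory Submission
  imports Defs
begin

section \<open>Gaussian moments in one variable and products of independent coordinates\<close>

abbreviation gauss :: "real measure" where
  "gauss \<equiv> density lborel std_normal_density"

interpretation gauss: prob_space gauss
  by (rule prob_space_normal_density) simp

interpretation gauss_prod: product_sigma_finite "\<lambda>_::nat. gauss"
  by unfold_locales

lemma integrable_gauss_iff:
  fixes f :: "real \<Rightarrow> real"
  assumes [measurable]: "f \<in> borel_measurable borel"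
  shows "integrable gauss f \<longleftrightarrow> integrable lborel (\<lambda>x. std_normal_density x * f x)"
  by (subst integrable_density) auto

lemma integral_gauss_eq:
  fixes f :: "real \<Rightarrow> real"
  assumes [measurable]: "f \<in> borel_measurable borel"
  shows "integral\<^sup>L gauss f = (\<integral>x. std_normal_density x * f x \<partial>lborel)"
  by (subst integral_density) auto

lemma integrable_gauss_abs: "integrable gauss (\<lambda>x. \<bar>x\<bar>)"
  using integrable_std_normal_moment_abs[of 1] by (simp add: integrable_gauss_iff)

text \<open>Normalising constant of the tilted density proportional to
  \<open>\<bar>t\<bar> * std_normal_density t\<close>.\<close>

definition abs_moment :: real where "abs_moment = (\<integral>x. \<bar>x\<bar> \<partial>gauss)"

lemma abs_moment_eq: "abs_moment = sqrt (2 / pi)"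
  using std_normal_moment_abs_odd[of 0]
  by (simp add: abs_moment_def integral_gauss_eq has_bochner_integral_iff)

lemma abs_moment_pos: "abs_moment > 0"
  by (simp add: abs_moment_eq)

text \<open>Independence of the coordinates. Every integral over R^N evaluated below is first
  brought into this product form.\<close>

lemma integral_prod_gaussian:
  fixes f :: "nat \<Rightarrow> real \<Rightarrow> real"
  assumes "\<And>i. i \<in> {1..d} \<Longrightarrow> integrable gauss (f i)"
  shows "integrable (std_gaussian d) (\<lambda>x. \<Prod>i=1..d. f i (x i))"
    and "(\<integral>x. (\<Prod>i=1..d. f i (x i)) \<partial>std_gaussian d) = (\<Prod>i=1..d. integral\<^sup>L gauss (f i))"
  unfolding std_gaussian_def using assms
  by (auto intro!: gauss_prod.product_integrable_prod gauss_prod.product_integral_prod)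

lemma L1_norm_coord_prod: "L1_norm N (coord_prod N) = abs_moment ^ N"
  using integral_prod_gaussian(2)[of N "\<lambda>_ x. \<bar>x\<bar>"] integrable_gauss_abs
  by (simp add: L1_norm_def coord_prod_def abs_prod abs_moment_def)

section \<open>The gradient of the coordinate product\<close>

lemma gradient_coord_prod:
  assumes "i \<in> {1..N}"
  shows "gradient (coord_prod N) x i = (\<Prod>j\<in>{1..N} - {i}. x j)"
proof -
  \<comment> \<open>In the single variable x_i the product is linear, its slope being the product of
    the other coordinates.\<close>
  have "(\<lambda>t. coord_prod N (x(i := t))) = (\<lambda>t. t * (\<Prod>j\<in>{1..N} - {i}. x j))"
    unfolding coord_prod_def using assms by (subst prod.remove[of _ i]) auto
  moreover have "((\<lambda>t. t * c) has_real_derivative c) (at y)" for c y :: real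
    by (auto intro!: derivative_eq_intros)
  ultimately show ?thesis
    by (simp add: gradient_def DERIV_imp_deriv)
qed

text \<open>Division-free form of D_i P = P / x_i, valid also where x_i = 0, so that no null set has
  to be removed.\<close>

lemma gradient_coord_prod_mult:
  assumes "i \<in> {1..N}"
  shows "x i * gradient (coord_prod N) x i = coord_prod N x"
  unfolding gradient_coord_prod[OF assms] coord_prod_def
  using assms by (subst (2) prod.remove[of _ i]) auto

text \<open>The Euclidean norm is dominated by the sum of the absolute partial derivatives, each a
  product of integrable one-variable functions. Integrability matters for lower bounds: the integral
  of a non-integrable function would be 0 by convention.\<close>

lemma integrable_L2_set_gradient_coord_prod:
  "integrable (std_gaussian N) (\<lambda>x. L2_set (gradient (coord_prod N) x) {1..N})"
proof -
  have int: "integrable (std_gaussian N) (\<lambda>x. gradient (coord_prod N) x i)" if i: "i \<in> {1..N}" for i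
  proof -
    have id: "integrable gauss (\<lambda>x. x)"
      using integrable_gauss_abs by (subst (asm) integrable_abs_iff) auto
    \<comment> \<open>The constant factor 1 in place of x_i restores a product over the full index
      set.\<close>
    have "gradient (coord_prod N) x i = (\<Prod>j=1..N. (if j = i then 1 else x j))" for x
      unfolding gradient_coord_prod[OF i] using i
      by (subst (2) prod.remove[of _ i]) (auto intro!: prod.cong)
    moreover have "integrable gauss (\<lambda>t. if j = i then 1 else t)" for j
      using id by (cases "j = i") auto
    ultimately show ?thesis
      using integral_prod_gaussian(1)[of N "\<lambda>j t. if j = i then 1 else t"] by simp
  qed
  have [measurable]: "(\<lambda>x. gradient (coord_prod N) x i) \<in> borel_measurable (std_gaussian N)"
    if "i \<in> {1..N}" for i
    using int[OF that] by auto
  show ?thesis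
  proof (rule Bochner_Integration.integrable_bound)
    show "integrable (std_gaussian N) (\<lambda>x. \<Sum>i=1..N. \<bar>gradient (coord_prod N) x i\<bar>)"
      using int by auto
    show "(\<lambda>x. L2_set (gradient (coord_prod N) x) {1..N}) \<in> borel_measurable (std_gaussian N)"
      unfolding L2_set_def by measurable
    show "AE x in std_gaussian N. norm (L2_set (gradient (coord_prod N) x) {1..N})
        \<le> norm (\<Sum>i=1..N. \<bar>gradient (coord_prod N) x i\<bar>)"
      by (auto intro!: AE_I2 order.trans[OF L2_set_le_sum_abs] simp: L2_set_nonneg)
  qed
qed

section \<open>Lower bound for the gradient norm by the second moment method\<close>

text \<open>For \<open>s\<close> random with mean \<open>t\<close>, this bounds the mean of \<open>sqrt s\<close> from below in terms of
  the variance of \<open>s\<close>.\<close>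
lemma sqrt_ge_quadratic:
  fixes s t :: real
  assumes "s \<ge> 0" "t > 0"
  shows "sqrt s \<ge> sqrt t * (3 * (s / t) - (s / t)\<^sup>2) / 2"
proof -
  define v where "v = sqrt (s / t)"
  have v: "v \<ge> 0" "v\<^sup>2 = s / t" using assms by (auto simp: v_def)
  \<comment> \<open>the cubic \<open>v\<^sup>3 - 3 * v + 2\<close> factors as \<open>(v - 1)\<^sup>2 * (v + 2)\<close>\<close>
  have "0 \<le> (v - 1)\<^sup>2 * (v + 2) * v" using v by simp
  also have "\<dots> = 2 * v - (3 * v\<^sup>2 - (v\<^sup>2)\<^sup>2)"
    by (simp add: power2_eq_square algebra_simps)
  finally have "(3 * (s / t) - (s / t)\<^sup>2) / 2 \<le> v" using v by simp
  then have "sqrt t * ((3 * (s / t) - (s / t)\<^sup>2) / 2) \<le> sqrt t * v"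
    using assms by (intro mult_left_mono) auto
  also have "sqrt t * v = sqrt s"
    using assms by (simp add: v_def real_sqrt_divide)
  finally show ?thesis by simp
qed

text \<open>Here \<open>g\<close> is a truncation of t^(-2), a condition written without division so
  that it also makes sense at t = 0. Since x_i D_i P = P, it gives P^2 g(x_i) \<le> (D_i P)^2 at
  every point; summation over i and a square root finish.\<close>

lemma L2_set_gradient_coord_prod_ge:
  assumes "\<And>t. 0 \<le> g t" "\<And>t. t\<^sup>2 * g t \<le> 1"
  shows "\<bar>coord_prod N x\<bar> * sqrt (\<Sum>i=1..N. g (x i)) \<le> L2_set (gradient (coord_prod N) x) {1..N}"
proof -
  have "(coord_prod N x)\<^sup>2 * g (x i) \<le> (gradient (coord_prod N) x i)\<^sup>2" if i: "i \<in> {1..N}" for i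
  proof -
    have "(coord_prod N x)\<^sup>2 * g (x i) = (gradient (coord_prod N) x i)\<^sup>2 * ((x i)\<^sup>2 * g (x i))"
      by (simp add: gradient_coord_prod_mult[OF i, symmetric] power_mult_distrib)
    also have "\<dots> \<le> (gradient (coord_prod N) x i)\<^sup>2 * 1"
      using assms by (intro mult_left_mono) auto
    finally show ?thesis by simp
  qed
  then have "(\<Sum>i=1..N. (coord_prod N x)\<^sup>2 * g (x i)) \<le> (\<Sum>i=1..N. (gradient (coord_prod N) x i)\<^sup>2)"
    by (intro sum_mono) auto
  then have "sqrt ((coord_prod N x)\<^sup>2 * (\<Sum>i=1..N. g (x i))) \<le> L2_set (gradient (coord_prod N) x) {1..N}"
    unfolding L2_set_def by (simp add: sum_distrib_left)
  then show ?thesis by (simp add: real_sqrt_mult)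
qed

text \<open>\<open>\<mu>\<close> and \<open>\<nu>\<close> are the mean and the second moment of \<open>g\<close> under the probability density
  proportional to \<open>\<bar>t\<bar> * std_normal_density t\<close>.\<close>
lemma tilted_moments:
  fixes g :: "real \<Rightarrow> real" and \<mu> \<nu> :: real
  assumes [measurable]: "g \<in> borel_measurable borel"
    and bound: "\<And>t. 0 \<le> g t" "\<And>t. g t \<le> B"
    and \<mu>: "(\<integral>t. \<bar>t\<bar> * g t \<partial>gauss) = abs_moment * \<mu>"
    and \<nu>: "(\<integral>t. \<bar>t\<bar> * (g t)\<^sup>2 \<partial>gauss) = abs_moment * \<nu>"
  defines "S \<equiv> \<lambda>N x. \<Sum>i=1..N. g (x i)"
  shows "integrable (std_gaussian N) (\<lambda>x. \<bar>coord_prod N x\<bar> * S N x)"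
    and "(\<integral>x. \<bar>coord_prod N x\<bar> * S N x \<partial>std_gaussian N) = abs_moment ^ N * (N * \<mu>)"
    and "integrable (std_gaussian N) (\<lambda>x. \<bar>coord_prod N x\<bar> * (S N x)\<^sup>2)"
    and "(\<integral>x. \<bar>coord_prod N x\<bar> * (S N x)\<^sup>2 \<partial>std_gaussian N)
      \<le> abs_moment ^ N * ((N * \<mu>)\<^sup>2 + N * \<nu>)"
proof -
  have abs_le: "\<bar>g t\<bar> \<le> \<bar>B\<bar>" for t using bound[of t] by linarith
  have gint: "integrable gauss (\<lambda>t. \<bar>t\<bar> * g t)"
    by (rule Bochner_Integration.integrable_bound[of _ "\<lambda>t. \<bar>B\<bar> * \<bar>t\<bar>"])
      (use abs_le integrable_gauss_abs in \<open>auto intro!: AE_I2 mult_left_mono simp: abs_mult mult.commute\<close>)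
  have g2: "(g t)\<^sup>2 \<le> B\<^sup>2" for t using bound by (intro power_mono) auto
  have g2int: "integrable gauss (\<lambda>t. \<bar>t\<bar> * (g t)\<^sup>2)"
    by (rule Bochner_Integration.integrable_bound[of _ "\<lambda>t. B\<^sup>2 * \<bar>t\<bar>"])
      (use g2 integrable_gauss_abs in \<open>auto intro!: AE_I2 simp: abs_mult mult.commute intro: mult_left_mono\<close>)
  note ints = gint g2int integrable_gauss_abs
  have m1: "integrable (std_gaussian N) (\<lambda>x. \<bar>coord_prod N x\<bar> * g (x j))"
    "(\<integral>x. \<bar>coord_prod N x\<bar> * g (x j) \<partial>std_gaussian N) = abs_moment ^ N * \<mu>"
    if j: "j \<in> {1..N}" for j
  proof -
    \<comment> \<open>Only factor j carries \<open>g\<close>, contributing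
      \<open>abs_moment * \<mu>\<close>; each other factor contributes
      \<open>abs_moment\<close>.\<close>
    let ?f = "\<lambda>i t. \<bar>t\<bar> * (if i = j then g t else 1)"
    have eq: "\<bar>coord_prod N x\<bar> * g (x j) = (\<Prod>i=1..N. ?f i (x i))" for x
      using j by (simp add: coord_prod_def abs_prod prod.distrib prod.delta)
    have f: "integrable gauss (?f i)" for i using ints by (cases "i = j") auto
    have "integral\<^sup>L gauss (?f i) = abs_moment * (if i = j then \<mu> else 1)" for i
      using \<mu> by (auto simp: abs_moment_def)
    then show "integrable (std_gaussian N) (\<lambda>x. \<bar>coord_prod N x\<bar> * g (x j))"
      "(\<integral>x. \<bar>coord_prod N x\<bar> * g (x j) \<partial>std_gaussian N) = abs_moment ^ N * \<mu>"
      unfolding eq using integral_prod_gaussian[of N ?f, OF f] j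
      by (simp_all add: prod.distrib prod.delta)
  qed
  have m2: "integrable (std_gaussian N) (\<lambda>x. \<bar>coord_prod N x\<bar> * (g (x j) * g (x k)))"
    "(\<integral>x. \<bar>coord_prod N x\<bar> * (g (x j) * g (x k)) \<partial>std_gaussian N) =
      abs_moment ^ N * (if j = k then \<nu> else \<mu>\<^sup>2)"
    if j: "j \<in> {1..N}" and k: "k \<in> {1..N}" for j k
  proof -
    \<comment> \<open>For j = k both weights fall on the same factor and give the second moment
      \<open>\<nu>\<close>; otherwise they fall on two independent factors and give
      \<open>\<mu>\<^sup>2\<close>.\<close>
    let ?f = "\<lambda>i t. \<bar>t\<bar> * ((if i = j then g t else 1) * (if i = k then g t else 1))"
    have eq: "\<bar>coord_prod N x\<bar> * (g (x j) * g (x k)) = (\<Prod>i=1..N. ?f i (x i))" for x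
      using j k by (simp add: coord_prod_def abs_prod prod.distrib prod.delta)
    have f: "integrable gauss (?f i)" for i
      using ints by (cases "i = j"; cases "i = k") (auto simp: power2_eq_square)
    have *: "integral\<^sup>L gauss (?f i) = abs_moment *
      (if j = k then (if i = j then \<nu> else 1) else (if i = j then \<mu> else 1) * (if i = k then \<mu> else 1))" for i
      using \<mu> \<nu> by (auto simp: abs_moment_def power2_eq_square)
    show "integrable (std_gaussian N) (\<lambda>x. \<bar>coord_prod N x\<bar> * (g (x j) * g (x k)))"
      unfolding eq using integral_prod_gaussian[of N ?f, OF f] by simp
    show "(\<integral>x. \<bar>coord_prod N x\<bar> * (g (x j) * g (x k)) \<partial>std_gaussian N) =
      abs_moment ^ N * (if j = k then \<nu> else \<mu>\<^sup>2)"
      unfolding eq integral_prod_gaussian(2)[of N ?f, OF f] * using j k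
      by (cases "j = k") (simp_all add: prod.distrib prod.delta power2_eq_square)
  qed
  have S1: "\<bar>coord_prod N x\<bar> * S N x = (\<Sum>j=1..N. \<bar>coord_prod N x\<bar> * g (x j))" for x
    by (simp add: S_def sum_distrib_left)
  have S2: "\<bar>coord_prod N x\<bar> * (S N x)\<^sup>2 = (\<Sum>j=1..N. \<Sum>k=1..N. \<bar>coord_prod N x\<bar> * (g (x j) * g (x k)))" for x
    unfolding S_def power2_eq_square by (subst sum_product) (simp add: sum_distrib_left)
  show "integrable (std_gaussian N) (\<lambda>x. \<bar>coord_prod N x\<bar> * S N x)"
    unfolding S1 using m1 by auto
  show "(\<integral>x. \<bar>coord_prod N x\<bar> * S N x \<partial>std_gaussian N) = abs_moment ^ N * (N * \<mu>)"
    unfolding S1 using m1 by (subst Bochner_Integration.integral_sum) auto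
  show "integrable (std_gaussian N) (\<lambda>x. \<bar>coord_prod N x\<bar> * (S N x)\<^sup>2)"
    unfolding S2 using m2 by (intro Bochner_Integration.integrable_sum) auto
  have \<nu>0: "\<nu> \<ge> 0"
  proof -
    have "0 \<le> abs_moment * \<nu>" unfolding \<nu>[symmetric] by (intro integral_nonneg_AE) auto
    then show ?thesis using abs_moment_pos by (simp add: zero_le_mult_iff)
  qed
  have "(\<integral>x. \<bar>coord_prod N x\<bar> * (S N x)\<^sup>2 \<partial>std_gaussian N) =
      (\<Sum>j=1..N. \<Sum>k=1..N. \<integral>x. \<bar>coord_prod N x\<bar> * (g (x j) * g (x k)) \<partial>std_gaussian N)"
    unfolding S2 using m2
    by (subst Bochner_Integration.integral_sum)
      (auto intro!: sum.cong Bochner_Integration.integral_sum Bochner_Integration.integrable_sum)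
  also have "\<dots> = (\<Sum>j=1..N. \<Sum>k=1..N. abs_moment ^ N * (if j = k then \<nu> else \<mu>\<^sup>2))"
    using m2(2) by (intro sum.cong) auto
  \<comment> \<open>Adding \<open>\<mu>\<^sup>2\<close> on the diagonal makes the double sum
    explicit, at a cost of lower order in N.\<close>
  also have "\<dots> \<le> (\<Sum>j=1..N. \<Sum>k=1..N. abs_moment ^ N * (\<mu>\<^sup>2 + (if j = k then \<nu> else 0)))"
    using \<nu>0 abs_moment_pos by (intro sum_mono mult_left_mono) auto
  also have "\<dots> = abs_moment ^ N * ((N * \<mu>)\<^sup>2 + N * \<nu>)"
    by (simp add: sum_distrib_left[symmetric] sum.distrib power2_eq_square algebra_simps)
  finally show "(\<integral>x. \<bar>coord_prod N x\<bar> * (S N x)\<^sup>2 \<partial>std_gaussian N)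
      \<le> abs_moment ^ N * ((N * \<mu>)\<^sup>2 + N * \<nu>)" .
qed

text \<open>The quadratic minorant of the square root is integrated with S = sum_i g(x_i) and t =
  \<open>N * \<mu>\<close>, the tilted mean of S. The linear term yields 3, the quadratic one at
  most 1 + \<open>\<nu> / (N * \<mu>\<^sup>2)\<close>; half the difference is the last factor of the
  bound.\<close>

lemma L1_norm_vec_gradient_coord_prod_ge:
  fixes g :: "real \<Rightarrow> real" and \<mu> \<nu> :: real
  assumes g: "g \<in> borel_measurable borel" "\<And>t. 0 \<le> g t" "\<And>t. g t \<le> B"
    and \<mu>: "(\<integral>t. \<bar>t\<bar> * g t \<partial>gauss) = abs_moment * \<mu>" "\<mu> > 0"
    and \<nu>: "(\<integral>t. \<bar>t\<bar> * (g t)\<^sup>2 \<partial>gauss) = abs_moment * \<nu>"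
    and sq: "\<And>t. t\<^sup>2 * g t \<le> 1" and N: "N \<ge> 1"
  shows "L1_norm_vec N (gradient (coord_prod N)) \<ge>
    abs_moment ^ N * sqrt (N * \<mu>) * (1 - \<nu> / (2 * real N * \<mu>\<^sup>2))"
proof -
  note mom = tilted_moments[OF g \<mu>(1) \<nu>, of N]
  define S where "S x = (\<Sum>i=1..N. g (x i))" for x
  define t where "t = N * \<mu>"
  have t: "t > 0" using \<mu> N by (simp add: t_def)
  \<comment> \<open>The minorant times |P_N|, expanded to be linear in the two integrands whose
    integrals are controlled.\<close>
  define h where "h x = sqrt t / 2 * (3 / t * (\<bar>coord_prod N x\<bar> * S x) - 1 / t\<^sup>2 * (\<bar>coord_prod N x\<bar> * (S x)\<^sup>2))" for x
  have le: "h x \<le> L2_set (gradient (coord_prod N) x) {1..N}" for x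
  proof -
    have "h x = \<bar>coord_prod N x\<bar> * (sqrt t * (3 * (S x / t) - (S x / t)\<^sup>2) / 2)"
      using t by (simp add: h_def field_simps power2_eq_square)
    also have "\<dots> \<le> \<bar>coord_prod N x\<bar> * sqrt (S x)"
      using g(2) t by (intro mult_left_mono sqrt_ge_quadratic) (auto simp: S_def intro: sum_nonneg)
    also have "\<dots> \<le> L2_set (gradient (coord_prod N) x) {1..N}"
      unfolding S_def by (rule L2_set_gradient_coord_prod_ge[OF g(2) sq])
    finally show ?thesis .
  qed
  have int: "integrable (std_gaussian N) h"
    unfolding h_def S_def using mom by auto
  have "abs_moment ^ N * sqrt (N * \<mu>) * (1 - \<nu> / (2 * real N * \<mu>\<^sup>2)) =
     sqrt t / 2 * (3 / t * (abs_moment ^ N * t) - 1 / t\<^sup>2 * (abs_moment ^ N * (t\<^sup>2 + N * \<nu>)))"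
  proof -
    have "N * \<nu> / t\<^sup>2 = \<nu> / (N * \<mu>\<^sup>2)" using N by (simp add: t_def field_simps power2_eq_square)
    then have "1 / t\<^sup>2 * (abs_moment ^ N * (t\<^sup>2 + N * \<nu>)) = abs_moment ^ N * (1 + \<nu> / (N * \<mu>\<^sup>2))"
      using t by (simp add: add_divide_distrib distrib_left flip: times_divide_eq_right)
    then show ?thesis using t
      unfolding t_def[symmetric] by (simp add: field_simps)
  qed
  \<comment> \<open>The second moment enters with a negative sign, so its upper bound is the one
    required.\<close>
  also have "\<dots> \<le> sqrt t / 2 * (3 / t * (\<integral>x. \<bar>coord_prod N x\<bar> * S x \<partial>std_gaussian N)
      - 1 / t\<^sup>2 * (\<integral>x. \<bar>coord_prod N x\<bar> * (S x)\<^sup>2 \<partial>std_gaussian N))"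
    using t mom(2) mom(4) unfolding S_def t_def[symmetric]
    by (intro mult_left_mono diff_mono) auto
  also have "\<dots> = integral\<^sup>L (std_gaussian N) h"
    unfolding h_def using mom(1,3) by (simp add: S_def)
  also have "\<dots> \<le> L1_norm_vec N (gradient (coord_prod N))"
    unfolding L1_norm_vec_def
    using int integrable_L2_set_gradient_coord_prod le by (intro integral_mono)
  finally show ?thesis .
qed

section \<open>Divergence of the truncated inverse moment and of the ratio\<close>

text \<open>On [\<open>\<epsilon>\<close>, 1] the integrand is 1/t, the Gaussian density is at least
  its value at 1, and 1/t integrates to \<open>- ln \<epsilon>\<close>. The bound is unbounded as
  \<open>\<epsilon>\<close> tends to 0.\<close>

lemma truncated_inverse_moment_ge:
  assumes "0 < \<epsilon>" "\<epsilon> \<le> 1"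
  shows "(\<integral>t. \<bar>t\<bar> * (indicator {\<epsilon>..1} t / t\<^sup>2) \<partial>gauss) \<ge> std_normal_density 1 * - ln \<epsilon>"
proof -
  have FTC: "has_bochner_integral lborel (\<lambda>t. inverse t * indicat_real {\<epsilon>..1} t) (ln 1 - ln \<epsilon>)"
    using assms by (intro has_bochner_integral_FTC_Icc_nonneg) (auto intro!: derivative_eq_intros simp: inverse_eq_divide)
  have ge1: "std_normal_density t \<ge> std_normal_density 1" if "0 \<le> t" "t \<le> 1" for t
    using that by (auto simp: std_normal_density_def field_simps intro!: divide_right_mono power_le_one)
  \<comment> \<open>This upper bound gives integrability, with 1/t on [\<open>\<epsilon>\<close>, 1]
    as the dominating function.\<close>
  have le1: "std_normal_density t \<le> 1" for t
  proof -
    have "1 \<le> sqrt (2 * pi)" using pi_ge_two by simp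
    moreover have "exp (- t\<^sup>2 / 2) \<le> 1" by simp
    ultimately have "exp (- t\<^sup>2 / 2) \<le> sqrt (2 * pi)" by linarith
    then show ?thesis by (simp add: std_normal_density_def)
  qed
  have eq: "std_normal_density t * (\<bar>t\<bar> * (indicator {\<epsilon>..1} t / t\<^sup>2)) =
      std_normal_density t * (inverse t * indicat_real {\<epsilon>..1} t)" for t
    using assms by (auto simp: indicator_def field_simps power2_eq_square)
  have "std_normal_density 1 * - ln \<epsilon> =
      (\<integral>t. std_normal_density 1 * (inverse t * indicat_real {\<epsilon>..1} t) \<partial>lborel)"
    using FTC by (simp add: has_bochner_integral_iff)
  also have "\<dots> \<le> (\<integral>t. std_normal_density t * (inverse t * indicat_real {\<epsilon>..1} t) \<partial>lborel)"
  proof (rule integral_mono)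
    show "integrable lborel (\<lambda>t. std_normal_density 1 * (inverse t * indicat_real {\<epsilon>..1} t))"
      using FTC by (auto simp: has_bochner_integral_iff)
    show "integrable lborel (\<lambda>t. std_normal_density t * (inverse t * indicat_real {\<epsilon>..1} t))"
    proof (rule Bochner_Integration.integrable_bound)
      show "integrable lborel (\<lambda>t. inverse t * indicat_real {\<epsilon>..1} t)"
        using FTC by (auto simp: has_bochner_integral_iff)
    qed (use le1 in \<open>auto intro!: AE_I2 mult_left_le_one_le simp: abs_mult\<close>)
    show "std_normal_density 1 * (inverse t * indicat_real {\<epsilon>..1} t)
        \<le> std_normal_density t * (inverse t * indicat_real {\<epsilon>..1} t)" for t
      using assms ge1[of t] by (auto simp: indicator_def)
  qed
  also have "\<dots> = (\<integral>t. \<bar>t\<bar> * (indicator {\<epsilon>..1} t / t\<^sup>2) \<partial>gauss)"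
    by (subst integral_gauss_eq) (simp_all only: eq, measurable)
  finally show ?thesis .
qed

text \<open>The truncation level depends on the target \<open>Z\<close> alone, so
  \<open>\<mu>\<close> and \<open>\<nu>\<close> stay fixed while N grows and the variance correction
  vanishes.\<close>

lemma filterlim_gradient_ratio_coord_prod:
  "filterlim (\<lambda>N. L1_norm_vec N (gradient (coord_prod N)) /
     (sqrt (real N) * L1_norm N (coord_prod N))) at_top sequentially"
  unfolding filterlim_at_top_gt[where c = 0]
proof safe
  fix Z :: real assume Z: "Z > 0"
  \<comment> \<open>Solves \<open>std_normal_density 1 * - ln \<epsilon> = abs_moment * (2 *
    Z)\<^sup>2\<close>, which forces \<open>sqrt \<mu> \<ge> 2 * Z\<close>. The 2 offsets the factor
    1/2 given up to the variance correction.\<close>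
  define \<epsilon> where "\<epsilon> = exp (- (abs_moment * (2 * Z)\<^sup>2 / std_normal_density 1))"
  have \<epsilon>: "0 < \<epsilon>" "\<epsilon> \<le> 1" using abs_moment_pos by (auto simp: \<epsilon>_def)
  define g where "g t = indicat_real {\<epsilon>..1} t / t\<^sup>2" for t
  define \<mu> where "\<mu> = (\<integral>t. \<bar>t\<bar> * g t \<partial>gauss) / abs_moment"
  define \<nu> where "\<nu> = (\<integral>t. \<bar>t\<bar> * (g t)\<^sup>2 \<partial>gauss) / abs_moment"
  have g: "g \<in> borel_measurable borel" unfolding g_def by measurable
  have g0: "0 \<le> g t" for t by (simp add: g_def)
  have gB: "g t \<le> 1 / \<epsilon>\<^sup>2" for t
    using \<epsilon> by (auto simp: g_def indicator_def intro!: divide_left_mono power_mono)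
  have sq: "t\<^sup>2 * g t \<le> 1" for t by (simp add: g_def indicator_def)
  have "abs_moment * (2 * Z)\<^sup>2 = std_normal_density 1 * - ln \<epsilon>"
    using normal_density_pos[of 1 0 1] by (simp add: \<epsilon>_def)
  also have "\<dots> \<le> (\<integral>t. \<bar>t\<bar> * g t \<partial>gauss)"
    unfolding g_def by (rule truncated_inverse_moment_ge[OF \<epsilon>])
  also have "\<dots> = abs_moment * \<mu>" using abs_moment_pos by (simp add: \<mu>_def)
  finally have \<mu>: "(2 * Z)\<^sup>2 \<le> \<mu>" using abs_moment_pos by simp
  then have \<mu>0: "\<mu> > 0" using Z by (smt (verit) zero_less_power)
  \<comment> \<open>From \<open>\<nu> / \<mu>\<^sup>2\<close> on, the correction
    \<open>\<nu> / (2 * N * \<mu>\<^sup>2)\<close> is at most 1/2; N \<ge> 1 keeps the denominators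
    positive.\<close>
  have "eventually (\<lambda>N. N \<ge> max 1 (nat \<lceil>\<nu> / \<mu>\<^sup>2\<rceil>)) sequentially" by (rule eventually_ge_at_top)
  then show "eventually (\<lambda>N. Z \<le> L1_norm_vec N (gradient (coord_prod N)) /
     (sqrt (real N) * L1_norm N (coord_prod N))) sequentially"
  proof eventually_elim
    case (elim N)
    then have N: "N \<ge> 1" "\<nu> / \<mu>\<^sup>2 \<le> N" by linarith+
    then have "\<nu> / (2 * real N * \<mu>\<^sup>2) \<le> 1 / 2" using \<mu>0 by (simp add: field_simps)
    then have half: "1 / 2 \<le> 1 - \<nu> / (2 * real N * \<mu>\<^sup>2)" by simp
    have "2 * Z \<le> sqrt \<mu>" using \<mu> by (rule real_le_rsqrt)
    then have "abs_moment ^ N * (sqrt N * (2 * Z)) * (1 / 2) \<le>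
        abs_moment ^ N * (sqrt N * sqrt \<mu>) * (1 - \<nu> / (2 * real N * \<mu>\<^sup>2))"
      using half abs_moment_pos Z \<mu>0 by (intro mult_mono) auto
    also have "\<dots> = abs_moment ^ N * sqrt (N * \<mu>) * (1 - \<nu> / (2 * real N * \<mu>\<^sup>2))"
      by (simp add: real_sqrt_mult)
    also have "\<dots> \<le> L1_norm_vec N (gradient (coord_prod N))"
      by (rule L1_norm_vec_gradient_coord_prod_ge[OF g g0 gB _ \<mu>0 _ sq])
        (use N abs_moment_pos in \<open>auto simp: \<mu>_def \<nu>_def\<close>)
    finally show ?case
      using abs_moment_pos N by (simp add: L1_norm_coord_prod le_divide_eq mult_ac)
  qed
qed

section \<open>The coordinate product as a formal polynomial, and the failure of a uniform
  constant\<close>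

definition coord_monomial :: "nat \<Rightarrow> nat \<Rightarrow>\<^sub>0 nat" where
  "coord_monomial N = (\<Sum>j=1..N. Poly_Mapping.single j 1)"

lemma lookup_coord_monomial:
  "Poly_Mapping.lookup (coord_monomial N) i = (if i \<in> {1..N} then 1 else 0)"
  unfolding coord_monomial_def lookup_sum lookup_single when_def
  by (subst sum.delta) auto

lemma keys_coord_monomial: "Poly_Mapping.keys (coord_monomial N) = {1..N}"
  by (auto simp: in_keys_iff lookup_coord_monomial split: if_splits)

text \<open>Links the function \<open>coord_prod N\<close> to the formal polynomials over which the
  second claim quantifies.\<close>

definition coord_prod_mpoly :: "nat \<Rightarrow> mpolynomial" where
  "coord_prod_mpoly N = Poly_Mapping.single (coord_monomial N) 1"

lemma coord_prod_mpoly_in_mpolys: "coord_prod_mpoly N \<in> mpolys N"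
  by (simp add: mpolys_def coord_prod_mpoly_def keys_coord_monomial)

lemma mpoly_eval_coord_prod_mpoly: "mpoly_eval (coord_prod_mpoly N) = coord_prod N"
  by (simp add: fun_eq_iff mpoly_eval_def coord_prod_mpoly_def keys_coord_monomial
      lookup_coord_monomial coord_prod_def)

lemma mpoly_degree_coord_prod_mpoly: "mpoly_degree (coord_prod_mpoly N) = N"
  by (simp add: mpoly_degree_def coord_prod_mpoly_def keys_coord_monomial lookup_coord_monomial)

text \<open>The diagonal points with all coordinates 0 and all coordinates 1 have different values;
  for N = 0 the empty product would be constant.\<close>

lemma coord_prod_not_constant_on:
  assumes "N \<ge> 1"
  shows "\<not> coord_prod N constant_on euclid N"
proof
  assume "coord_prod N constant_on euclid N"
  \<comment> \<open>Restriction to the index set makes the diagonal point extensional, as membership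
    in \<open>euclid N\<close> demands.\<close>
  moreover have "(\<lambda>i\<in>{1..N}. c) \<in> euclid N" for c :: real by (auto simp: euclid_def)
  moreover have "coord_prod N (\<lambda>i\<in>{1..N}. c) = c ^ N" for c by (simp add: coord_prod_def)
  ultimately have "(0::real) ^ N = 1 ^ N" unfolding constant_on_def by metis
  then show False using assms by (simp add: power_0_left)
qed

theorem mainTheorem8:
  shows "filterlim (\<lambda>N. L1_norm_vec N (gradient (coord_prod N)) /
             (sqrt (real N) * L1_norm N (coord_prod N))) at_top sequentially \<and>
         \<not> (\<exists>C::real. \<forall>d\<ge>1. \<forall>p\<in>mpolys d. \<not> mpoly_eval p constant_on euclid d \<longrightarrow>
             L1_norm_vec d (gradient (mpoly_eval p)) \<le>
               C * sqrt (real (mpoly_degree p)) * L1_norm d (mpoly_eval p))"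
proof (intro conjI notI; (elim exE)?)
  show lim: "filterlim (\<lambda>N. L1_norm_vec N (gradient (coord_prod N)) /
      (sqrt (real N) * L1_norm N (coord_prod N))) at_top sequentially"
    by (rule filterlim_gradient_ratio_coord_prod)
  fix C :: real
  assume C: "\<forall>d\<ge>1. \<forall>p\<in>mpolys d. \<not> mpoly_eval p constant_on euclid d \<longrightarrow>
             L1_norm_vec d (gradient (mpoly_eval p)) \<le>
               C * sqrt (real (mpoly_degree p)) * L1_norm d (mpoly_eval p)"
  \<comment> \<open>A single N whose ratio exceeds \<open>C\<close> refutes the bound, since P_N has
    degree exactly N.\<close>
  have "eventually (\<lambda>N. C < L1_norm_vec N (gradient (coord_prod N)) /
      (sqrt (real N) * L1_norm N (coord_prod N)) \<and> N \<ge> 1) sequentially"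
    using lim by (intro eventually_conj eventually_ge_at_top) (simp add: filterlim_at_top_dense)
  then obtain N where N: "N \<ge> 1" and less: "C < L1_norm_vec N (gradient (coord_prod N)) /
      (sqrt (real N) * L1_norm N (coord_prod N))"
    using eventually_happens'[OF sequentially_bot] by blast
  have "L1_norm_vec N (gradient (coord_prod N)) \<le> C * sqrt N * L1_norm N (coord_prod N)"
    using C[rule_format, OF N coord_prod_mpoly_in_mpolys] coord_prod_not_constant_on[OF N]
    by (simp add: mpoly_eval_coord_prod_mpoly mpoly_degree_coord_prod_mpoly)
  moreover have "0 < sqrt N * L1_norm N (coord_prod N)"
    using N abs_moment_pos by (simp add: L1_norm_coord_prod)
  ultimately show False
    using less by (simp add: less_divide_eq mult_ac)
qed

end
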